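(* Let $k>0$, let $g_{0R},g_{0I},g_{1R},g_{1I}\in\mathbb{R}$, let $f_R,f_I:[0,1]\to\mathbb{R}$ be sufficiently smooth (at least $C^1$), and let $\lambda_1,\lambda_2>0$, $\lambda_3,\lambda_4<0$. Let $A,B,B_0,B_1,\vec F,\vec G_0,\vec G_1$ be as given in the context, let $\vec Q_0:[0,1]\to\mathbb{R}^4$ be an arbitrary initial value, and let $\vec Q:[0,\infty)\times[0,1]\to\mathbb{R}^4$ be a smooth (class $C^2$) solution of $$\frac{\partial \vec Q}{\partial t}+A\frac{\partial \vec Q}{\partial x}=B\vec Q+\vec F,\quad t>0,\ 0<x<1,$$ $$\vec Q(0,x)=\vec Q_0(x),\ 0<x<1,\qquad B_0\vec Q(t,0)=\vec G_0,\quad B_1\vec Q(t,1)=\vec G_1,\quad t\ge 0.$$ If $\lambda_1=\lambda_2$ and $\lambda_3=\lambda_4$, then $\vec Q$ reaches a steady state in finite time: there exists $T<\infty$ such that $\dfrac{\partial \vec Q}{\partial t}(t,x)=0$ for all $t>T$ and all $x\in[0,1]$.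
   Context: The vectors and matrices are $$\vec G_0=(g_{0R},g_{0I},0,0)^T,\qquad \vec G_1=(0,0,g_{1R},g_{1I})^T,$$ $$B_0=\begin{pmatrix}k&0&1&0\\ 0&k&0&1\\ 0&0&0&0\\ 0&0&0&0\end{pmatrix},\qquad B_1=\begin{pmatrix}0&0&0&0\\ 0&0&0&0\\ 0&k&1&0\\ -k&0&0&1\end{pmatrix},$$ $$\vec F=\frac12\begin{pmatrix}[f_I(\lambda_2-\lambda_4)+f_R(\lambda_1-\lambda_3)]\frac1k\\ [f_I(\lambda_2-\lambda_4)+f_R(\lambda_3-\lambda_1)]\frac1k\\ f_I(\lambda_4-\lambda_2)+f_R(\lambda_1+\lambda_3)\\ f_I(\lambda_2+\lambda_4)+f_R(\lambda_1-\lambda_3)\end{pmatrix},$$ $$A=\frac12\begin{pmatrix}\lambda_1+\lambda_4&\lambda_2-\lambda_3&(\lambda_1-\lambda_3)\frac1k&(\lambda_2-\lambda_4)\frac1k\\ \lambda_4-\lambda_1&\lambda_2+\lambda_3&(\lambda_3-\lambda_1)\frac1k&(\lambda_2-\lambda_4)\frac1k\\ (\lambda_1-\lambda_4)k&(\lambda_3-\lambda_2)k&\lambda_1+\lambda_3&\lambda_4-\lambda_2\\ (\lambda_1-\lambda_4)k&(\lambda_2-\lambda_3)k&\lambda_1-\lambda_3&\lambda_4+\lambda_2\end{pmatrix},$$ $$B=\frac12\begin{pmatrix}(\lambda_3-\lambda_1)k&(\lambda_4-\lambda_2)k&\lambda_1+\lambda_4&\lambda_2-\lambda_3\\ (\lambda_1-\lambda_3)k&(\lambda_4-\lambda_2)k&\lambda_4-\lambda_1&\lambda_2+\lambda_3\\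 -(\lambda_1+\lambda_3)k^2&(\lambda_2-\lambda_4)k^2&(\lambda_1-\lambda_4)k&(\lambda_3-\lambda_2)k\\ (\lambda_3-\lambda_1)k^2&-(\lambda_2+\lambda_4)k^2&(\lambda_1-\lambda_4)k&(\lambda_2-\lambda_3)k\end{pmatrix}.$$ *)

theory Defs
  imports "HOL-Analysis.Analysis"
begin

text \<open>
  Continuous differentiability on an arbitrary set, with Frechet derivatives taken within the set
  (hence one-sided on the boundary).  On the sets used below, which are convex with nonempty
  interior, such derivatives are unique.
\<close>

definition C1_on :: "'a::real_normed_vector set \<Rightarrow> ('a \<Rightarrow> 'b::real_normed_vector) \<Rightarrow> bool" where
  "C1_on S f \<longleftrightarrow> (\<exists>f' :: 'a \<Rightarrow> 'a \<Rightarrow>\<^sub>L 'b.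
     (\<forall>x\<in>S. (f has_derivative blinfun_apply (f' x)) (at x within S)) \<and> continuous_on S f')"

definition C2_on :: "'a::real_normed_vector set \<Rightarrow> ('a \<Rightarrow> 'b::real_normed_vector) \<Rightarrow> bool" where
  "C2_on S f \<longleftrightarrow> (\<exists>f' :: 'a \<Rightarrow> 'a \<Rightarrow>\<^sub>L 'b.
     (\<forall>x\<in>S. (f has_derivative blinfun_apply (f' x)) (at x within S)) \<and> C1_on S f')"

definition G0 :: "real \<Rightarrow> real \<Rightarrow> real^4" where
  "G0 g0R g0I = vector [g0R, g0I, 0, 0]"

definition G1 :: "real \<Rightarrow> real \<Rightarrow> real^4" where
  "G1 g1R g1I = vector [0, 0, g1R, g1I]"

definition B0 :: "real \<Rightarrow> real^4^4" where
  "B0 k = vector [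
     vector [k, 0, 1, 0],
     vector [0, k, 0, 1],
     vector [0, 0, 0, 0],
     vector [0, 0, 0, 0]]"

definition B1 :: "real \<Rightarrow> real^4^4" where
  "B1 k = vector [
     vector [0, 0, 0, 0],
     vector [0, 0, 0, 0],
     vector [0, k, 1, 0],
     vector [-k, 0, 0, 1]]"

definition F_vec :: "real \<Rightarrow> real \<Rightarrow> real \<Rightarrow> real \<Rightarrow> real \<Rightarrow>
    (real \<Rightarrow> real) \<Rightarrow> (real \<Rightarrow> real) \<Rightarrow> real \<Rightarrow> real^4" where
  "F_vec k l1 l2 l3 l4 fR fI x = (1/2) *\<^sub>R vector [
     (fI x * (l2 - l4) + fR x * (l1 - l3)) * (1/k),
     (fI x * (l2 - l4) + fR x * (l3 - l1)) * (1/k),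
     fI x * (l4 - l2) + fR x * (l1 + l3),
     fI x * (l2 + l4) + fR x * (l1 - l3)]"

definition A_mat :: "real \<Rightarrow> real \<Rightarrow> real \<Rightarrow> real \<Rightarrow> real \<Rightarrow> real^4^4" where
  "A_mat k l1 l2 l3 l4 = (1/2) *\<^sub>R vector [
     vector [l1 + l4, l2 - l3, (l1 - l3) * (1/k), (l2 - l4) * (1/k)],
     vector [l4 - l1, l2 + l3, (l3 - l1) * (1/k), (l2 - l4) * (1/k)],
     vector [(l1 - l4) * k, (l3 - l2) * k, l1 + l3, l4 - l2],
     vector [(l1 - l4) * k, (l2 - l3) * k, l1 - l3, l4 + l2]]"

definition B_mat :: "real \<Rightarrow> real \<Rightarrow> real \<Rightarrow> real \<Rightarrow> real \<Rightarrow> real^4^4" where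
  "B_mat k l1 l2 l3 l4 = (1/2) *\<^sub>R vector [
     vector [(l3 - l1) * k, (l4 - l2) * k, l1 + l4, l2 - l3],
     vector [(l1 - l3) * k, (l4 - l2) * k, l4 - l1, l2 + l3],
     vector [- (l1 + l3) * k^2, (l2 - l4) * k^2, (l1 - l4) * k, (l3 - l2) * k],
     vector [(l3 - l1) * k^2, - (l2 + l4) * k^2, (l1 - l4) * k, (l2 - l3) * k]]"

end

theory Submission
  imports Defs
begin

text \<open>
  Write u = Q1 + i Q2 and w = Q3 + i Q4.  When l1 = l2 and l3 = l4, the functionals
  y = k u + w and z = - i k u + w are left eigenvectors of A for l1 and l3, the boundary
  conditions prescribe y at x = 0 and z at x = 1, and B couples them triangularly: z B is a
  multiple of z.  The difference D of Q and a time translate of Q solves the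
  homogeneous problem.  Following the characteristics that enter at x = 1 gives z D = 0 once
  t \<ge> -1/l3; the equation for y D then decouples as well, and the characteristics that enter at
  x = 0 give y D = 0 once t \<ge> -1/l3 + 1/l1.  As y and z together determine the vector, Q is
  constant in time from then on.  Using translates rather than the time derivative of Q avoids
  second derivatives.
\<close>

section \<open>The matrices seen through the two characteristic functionals\<close>

lemma vector_4 [simp]:
  "(vector [x, y, z, w] :: 'a::zero^4) $ 1 = x"
  "(vector [x, y, z, w] :: 'a::zero^4) $ 2 = y"
  "(vector [x, y, z, w] :: 'a::zero^4) $ 3 = z"
  "(vector [x, y, z, w] :: 'a::zero^4) $ 4 = w"
  unfolding vector_def by simp_all

lemma matrix_vector_mult_4:
  "(A *v v) $ i = A $ i $ 1 * v $ 1 + A $ i $ 2 * v $ 2 + A $ i $ 3 * v $ 3 + A $ i $ 4 * v $ 4"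
  for A :: "real^4^'n"
  by (simp add: matrix_vector_mult_def sum_4)

text \<open>The overview's y and z are the cases c = k and c = - \<i> * k. Complex values pack the
  two real left eigenvectors of each double eigenvalue into one functional, which is only
  real-linear in \<open>v\<close>.\<close>

definition char_fun :: "complex \<Rightarrow> real^4 \<Rightarrow> complex" where
  "char_fun c v = c * Complex (v $ 1) (v $ 2) + Complex (v $ 3) (v $ 4)"

lemma bounded_linear_char_fun: "bounded_linear (char_fun c)"
  unfolding linear_conv_bounded_linear[symmetric]
  by (rule linearI) (simp_all add: char_fun_def complex_eq_iff algebra_simps)

lemmas char_fun_add = linear_add[OF bounded_linear.linear[OF bounded_linear_char_fun]]
  and char_fun_diff = linear_diff[OF bounded_linear.linear[OF bounded_linear_char_fun]]
  and char_fun_scaleR = linear_cmul[OF bounded_linear.linear[OF bounded_linear_char_fun]]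

lemma char_fun_A_mat:
  assumes "k \<noteq> 0"
  shows "char_fun k (A_mat k l l m m *v v) = l * char_fun k v"
    and "char_fun (- \<i> * k) (A_mat k l l m m *v v) = m * char_fun (- \<i> * k) v"
  using assms
  by (simp_all add: char_fun_def A_mat_def matrix_vector_mult_4 complex_eq_iff algebra_simps
      add_divide_distrib diff_divide_distrib)

lemma char_fun_B_mat:
  "char_fun k (B_mat k l l m m *v v)
     = l * k * (\<i> * char_fun k v + (1 - \<i>) * char_fun (- \<i> * k) v)"
  "char_fun (- \<i> * k) (B_mat k l l m m *v v) = - \<i> * k * m * char_fun (- \<i> * k) v"
  by (auto simp: char_fun_def B_mat_def matrix_vector_mult_4 complex_eq_iff algebra_simps
      power2_eq_square add_divide_distrib diff_divide_distrib)

text \<open>The nonzero rows of \<open>B0 k\<close> are the real and imaginary parts of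
  \<open>char_fun k\<close>. Comparing two vectors, rather than fixing the boundary value, suits the
  difference of a solution at two times.\<close>

lemma char_fun_boundary0:
  assumes "B0 k *v v = B0 k *v w"
  shows "char_fun k v = char_fun k w"
  using assms by (simp add: char_fun_def B0_def vec_eq_iff forall_4 matrix_vector_mult_4
      complex_eq_iff)

lemma char_fun_boundary1:
  assumes "B1 k *v v = B1 k *v w"
  shows "char_fun (- \<i> * k) v = char_fun (- \<i> * k) w"
  using assms by (simp add: char_fun_def B1_def vec_eq_iff forall_4 matrix_vector_mult_4
      complex_eq_iff)

text \<open>The two functionals differ by a nonzero multiple of u, namely (1 + \<i>) k u, so u and
  then w can be recovered.\<close>

lemma char_fun_inject:
  assumes "k \<noteq> 0" and "char_fun (of_real k) v = char_fun (of_real k) w"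
    and "char_fun (- \<i> * k) v = char_fun (- \<i> * k) w"
  shows "v = w"
proof -
  have "k * v $ 1 + v $ 3 = k * w $ 1 + w $ 3" "k * v $ 2 + v $ 4 = k * w $ 2 + w $ 4"
    "k * v $ 2 + v $ 3 = k * w $ 2 + w $ 3" "v $ 4 - k * v $ 1 = w $ 4 - k * w $ 1"
    using assms(2,3) by (auto simp: char_fun_def complex_eq_iff)
  then have "k * v $ 1 = k * w $ 1" "k * v $ 2 = k * w $ 2"
    by linarith+
  with assms show ?thesis
    by (simp add: char_fun_def complex_eq_iff vec_eq_iff forall_4)
qed

section \<open>Vanishing along characteristics\<close>

lemma linear_ode_zero:
  fixes p :: "real \<Rightarrow> complex"
  assumes "a \<le> b" and "continuous_on {a..b} p"
    and der: "\<And>t. a < t \<Longrightarrow> t < b \<Longrightarrow> (p has_vector_derivative c * p t) (at t)"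
    and "p a = 0"
  shows "p b = 0"
proof -
  \<comment> \<open>The integrating factor makes \<open>?q\<close> constant. The endpoints are
    exceptional points where continuity suffices, since the equation is only known in
    between.\<close>
  let ?q = "\<lambda>t. exp (- (c * of_real t)) * p t"
  have "?q b = 0"
  proof (rule has_derivative_zero_unique_strong_interval[of "{a, b}" a b])
    show "continuous_on {a..b} ?q"
      by (intro continuous_intros assms)
    fix t assume t: "t \<in> {a..b} - {a, b}"
    have e: "((\<lambda>t. exp (- (c * of_real t))) has_vector_derivative
        - c * exp (- (c * of_real t))) (at t)"
      by (rule has_vector_derivative_real_field) (auto intro!: derivative_eq_intros)
    have "(?q has_vector_derivative 0) (at t)"
      using has_vector_derivative_mult[OF e der] t by (simp add: algebra_simps)
    then show "(?q has_derivative (\<lambda>h. 0)) (at t within {a..b})"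
      by (auto simp: has_vector_derivative_def intro: has_derivative_at_withinI)
  qed (use assms in auto)
  then show ?thesis
    by simp
qed

text \<open>Along the line through (t, x) of slope c, the derivative of \<open>p\<close> is its
  directional derivative along (1, c), so the equation becomes a linear ODE. The sign of c is left
  open in order to cover waves entering from either end.\<close>

lemma transport_zero:
  fixes p :: "real \<times> real \<Rightarrow> complex"
  assumes "s \<le> t" and "continuous_on ({s..t} \<times> {0..1}) p"
    and der: "\<And>r y. s < r \<Longrightarrow> r < t \<Longrightarrow> 0 < y \<Longrightarrow> y < 1 \<Longrightarrow>
      \<exists>p'. (p has_derivative p') (at (r, y)) \<and> p' (1, c) = a * p (r, y)"
    and "c \<noteq> 0" and ends: "x \<in> {0..1}" "x + c * (s - t) \<in> {0..1}"
    and "p (s, x + c * (s - t)) = 0"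
  shows "p (t, x) = 0"
proof -
  let ?g = "\<lambda>r. (r, x + c * (r - t))"
  have range: "x + c * (r - t) \<in> {0..1}" if "s \<le> r" "r \<le> t" for r
  proof (cases "c > 0")
    case True
    then have "c * (s - t) \<le> c * (r - t)" "c * (r - t) \<le> 0"
      using that by (simp_all add: mult_le_0_iff)
    then show ?thesis using ends by simp
  next
    case False
    then have "c * (s - t) \<ge> c * (r - t)" "c * (r - t) \<ge> 0"
      using that by (simp_all add: zero_le_mult_iff mult_left_mono_neg)
    then show ?thesis using ends by simp
  qed
  \<comment> \<open>Since c is nonzero, the line touches the lateral boundary at most at its two end
    times, so derivatives are needed only in the open strip.\<close>
  have range': "0 < x + c * (r - t) \<and> x + c * (r - t) < 1" if "s < r" "r < t" for r
  proof (cases "c > 0")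
    case True
    then have "c * (s - t) < c * (r - t)" "c * (r - t) < 0"
      using that by (simp_all add: mult_less_0_iff)
    then show ?thesis using ends by simp
  next
    case False
    then have "c * (s - t) > c * (r - t)" "c * (r - t) > 0"
      using that \<open>c \<noteq> 0\<close> by (simp_all add: zero_less_mult_iff)
    then show ?thesis using ends by simp
  qed
  have "(p \<circ> ?g) t = 0"
  proof (rule linear_ode_zero[of s t "p \<circ> ?g" a])
    show "continuous_on {s..t} (p \<circ> ?g)"
      by (intro continuous_on_compose continuous_on_subset[OF assms(2)] continuous_intros)
        (use range in auto)
    show "((p \<circ> ?g) has_vector_derivative a * (p \<circ> ?g) r) (at r)" if r: "s < r" "r < t" for r
    proof -
      obtain p' where p': "(p has_derivative p') (at (?g r))" "p' (1, c) = a * p (?g r)"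
        using der r range' by blast
      have "(?g has_derivative (\<lambda>h. h *\<^sub>R (1, c))) (at r)"
        by (auto intro!: derivative_eq_intros simp: algebra_simps)
      from diff_chain_at[OF this p'(1)]
      have "((p \<circ> ?g) has_derivative (\<lambda>h. p' (h *\<^sub>R (1, c)))) (at r)"
        by (simp add: o_def)
      then show ?thesis
        using p'(2) by (simp add: has_vector_derivative_def
            linear_cmul[OF has_derivative_linear[OF p'(1)]] scaleR_conv_of_real del: scaleR_Pair)
    qed
  qed (use assms in auto)
  then show ?thesis
    by simp
qed

section \<open>Time translates of the solution and the steady state\<close>

theorem theorem2p2:
  fixes k g0R g0I g1R g1I l1 l2 l3 l4 :: real
    and fR fI :: "real \<Rightarrow> real"
    and Q0 :: "real \<Rightarrow> real^4"
    and Q :: "real \<Rightarrow> real \<Rightarrow> real^4"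
  assumes "k > 0"
    and "C1_on {0..1} fR" and "C1_on {0..1} fI"
    and "l1 > 0" and "l2 > 0" and "l3 < 0" and "l4 < 0"
    and "C2_on ({0..} \<times> {0..1}) (\<lambda>(t, x). Q t x)"
    and pde: "\<And>t x. t > 0 \<Longrightarrow> 0 < x \<Longrightarrow> x < 1 \<Longrightarrow>
      vector_derivative (\<lambda>s. Q s x) (at t)
        + A_mat k l1 l2 l3 l4 *v vector_derivative (\<lambda>y. Q t y) (at x)
      = B_mat k l1 l2 l3 l4 *v Q t x + F_vec k l1 l2 l3 l4 fR fI x"
    and initial: "\<And>x. 0 < x \<Longrightarrow> x < 1 \<Longrightarrow> Q 0 x = Q0 x"
    and boundary0: "\<And>t. t \<ge> 0 \<Longrightarrow> B0 k *v Q t 0 = G0 g0R g0I"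
    and boundary1: "\<And>t. t \<ge> 0 \<Longrightarrow> B1 k *v Q t 1 = G1 g1R g1I"
    and "l1 = l2" and "l3 = l4"
  shows "\<exists>T\<ge>0. \<forall>t>T. \<forall>x\<in>{0..1}. ((\<lambda>s. Q s x) has_vector_derivative 0) (at t)"
proof -
  define q where "q = (\<lambda>(t, x). Q t x)"
  define A where "A = A_mat k l1 l1 l3 l3"
  define B where "B = B_mat k l1 l1 l3 l3"
  define F where "F = F_vec k l1 l2 l3 l4 fR fI"
  have k: "k \<noteq> 0" and ls: "l1 > 0" "l3 < 0"
    using assms(1,4,6) by simp_all
  obtain f' :: "real \<times> real \<Rightarrow> (real \<times> real) \<Rightarrow>\<^sub>L (real^4)" where
    f': "\<And>z. z \<in> {0..} \<times> {0..1} \<Longrightarrow>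
      (q has_derivative f' z) (at z within {0..} \<times> {0..1})"
    using assms(8) unfolding C2_on_def q_def[symmetric] by blast
  have cont: "continuous_on ({0..} \<times> {0..1}) q"
    by (rule has_derivative_continuous_on[OF f'])
  have q_der: "(q has_derivative f' (t, x)) (at (t, x))" if "t > 0" "0 < x" "x < 1" for t x
  proof -
    have "(t, x) \<in> interior ({0..} \<times> {0..1})"
      using that by (simp add: interior_Times interior_real_atLeast)
    from at_within_interior[OF this] show ?thesis
      using f'[of "(t, x)"] that by simp
  qed
  \<comment> \<open>Restricting the Frechet derivative to the coordinate lines shows that both
    partial derivatives exist, which identifies the values of \<open>vector_derivative\<close> in
    the equation.\<close>
  have q_pde: "f' (t, x) (1, 0) + A *v f' (t, x) (0, 1) = B *v q (t, x) + F x"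
    if "t > 0" "0 < x" "x < 1" for t x
  proof -
    note d = q_der[OF that]
    have "((\<lambda>s. (s, x)) has_derivative (\<lambda>h. h *\<^sub>R (1, 0))) (at t)"
      by (auto intro!: derivative_eq_intros)
    from diff_chain_at[OF this, of q "f' (t, x)"] d
    have "((\<lambda>s. Q s x) has_vector_derivative f' (t, x) (1, 0)) (at t)"
      by (simp add: o_def q_def has_vector_derivative_def blinfun.scaleR_right del: scaleR_Pair)
    moreover
    have "((\<lambda>y. (t, y)) has_derivative (\<lambda>h. h *\<^sub>R (0, 1))) (at x)"
      by (auto intro!: derivative_eq_intros)
    from diff_chain_at[OF this, of q "f' (t, x)"] d
    have "((\<lambda>y. Q t y) has_vector_derivative f' (t, x) (0, 1)) (at x)"
      by (simp add: o_def q_def has_vector_derivative_def blinfun.scaleR_right del: scaleR_Pair)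
    ultimately show ?thesis
      using pde[OF that] assms(13,14)
      by (simp add: vector_derivative_at q_def A_def B_def F_def)
  qed
  \<comment> \<open>\<open>F\<close> and the boundary data are independent of time, so they cancel
    in this difference.\<close>
  define D where "D = (\<lambda>h (t, x). q (t + h, x) - q (t, x))"
  have D_cont: "continuous_on ({s..t} \<times> {0..1}) (\<lambda>z. char_fun c (D h z))"
    if "h > 0" "s \<ge> 0" for h s t c
    unfolding D_def split_def
    by (intro bounded_linear.continuous_on[OF bounded_linear_char_fun] continuous_intros
        continuous_on_compose2[OF cont]) (use that in auto)
  have D_der: "\<exists>D'. ((\<lambda>z. char_fun c (D h z)) has_derivative D') (at (t, x)) \<and>
      D' (1, l) = char_fun c (B *v D h (t, x))"
    if "h > 0" "t > 0" "0 < x" "x < 1" and eig: "\<And>v. char_fun c (A *v v) = of_real l * char_fun c v"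
    for h t x c and l :: real
  proof -
    \<comment> \<open>Under a left eigenvector for l, \<open>l\<close> times the x-derivative may be
      replaced by \<open>A\<close> applied to it, so the direction (1, l) sees exactly the left side
      of the PDE.\<close>
    have char: "char_fun c (f' (s, x) (1, l)) = char_fun c (B *v q (s, x)) + char_fun c (F x)"
      if "s > 0" for s
    proof -
      have "f' (s, x) (1, l) = f' (s, x) (1, 0) + l *\<^sub>R f' (s, x) (0, 1)"
        by (simp flip: blinfun.scaleR_right blinfun.add_right)
      then have "char_fun c (f' (s, x) (1, l)) = char_fun c (f' (s, x) (1, 0) + A *v f' (s, x) (0, 1))"
        by (simp add: char_fun_add char_fun_scaleR eig flip: scaleR_conv_of_real)
      also have "\<dots> = char_fun c (B *v q (s, x)) + char_fun c (F x)"
        using q_pde[of s x] \<open>s > 0\<close> \<open>0 < x\<close> \<open>x < 1\<close> by (simp add: char_fun_add)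
      finally show ?thesis .
    qed
    have "((\<lambda>z. (fst z + h, snd z)) has_derivative (\<lambda>z. z)) (at (t, x))"
      by (auto intro!: derivative_eq_intros)
    from diff_chain_at[OF this, of q "f' (t + h, x)"] q_der[of "t + h" x] that
    have shifted: "((\<lambda>z. q (fst z + h, snd z)) has_derivative f' (t + h, x)) (at (t, x))"
      by (simp add: o_def)
    have "((\<lambda>z. char_fun c (q (fst z + h, snd z) - q z)) has_derivative
        (\<lambda>z. char_fun c (f' (t + h, x) z - f' (t, x) z))) (at (t, x))"
      by (intro bounded_linear.has_derivative[OF bounded_linear_char_fun] has_derivative_diff
          shifted q_der that)
    then have "((\<lambda>z. char_fun c (D h z)) has_derivative
        (\<lambda>z. char_fun c (f' (t + h, x) z - f' (t, x) z))) (at (t, x))"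
      by (simp add: D_def split_def)
    moreover have "char_fun c (f' (t + h, x) (1, l) - f' (t, x) (1, l))
        = char_fun c (B *v D h (t, x))"
      using char[of "t + h"] char[of t] that
      by (simp add: D_def char_fun_diff matrix_vector_mult_diff_distrib)
    ultimately show ?thesis
      by blast
  qed
  have eig: "char_fun k (A *v v) = l1 * char_fun k v"
      "char_fun (- \<i> * k) (A *v v) = l3 * char_fun (- \<i> * k) v" for v
    unfolding A_def by (rule char_fun_A_mat[OF k])+
  have D_minus: "char_fun (- \<i> * k) (D h (t, x)) = 0"
    if "h > 0" "t \<ge> - 1 / l3" "x \<in> {0..1}" for h t x
  \<comment> \<open>This s is the time at which the characteristic of speed l3 through (t, x) leaves
    x = 1. The bound on t, one full crossing time, ensures s \<ge> 0.\<close>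
  proof (rule transport_zero[where s = "t + (1 - x) / l3" and c = l3 and a = "- \<i> * k * l3"])
    have "(1 - x) / l3 \<ge> 1 / l3"
      using that ls by (intro divide_right_mono_neg) auto
    then have s: "t + (1 - x) / l3 \<ge> 0"
      using that by simp
    then show "continuous_on ({t + (1 - x) / l3..t} \<times> {0..1})
        (\<lambda>z. char_fun (- \<i> * k) (D h z))"
      using that by (intro D_cont)
    show "t + (1 - x) / l3 \<le> t"
      using that ls by (simp add: divide_nonneg_neg)
    have x1: "x + l3 * (t + (1 - x) / l3 - t) = 1"
      using ls by simp
    then show "x + l3 * (t + (1 - x) / l3 - t) \<in> {0..1}"
      by simp
    have "B1 k *v q (t + (1 - x) / l3 + h, 1) = B1 k *v q (t + (1 - x) / l3, 1)"
      using boundary1 s that by (simp add: q_def)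
    from char_fun_boundary1[OF this]
    show "char_fun (- \<i> * k)
        (D h (t + (1 - x) / l3, x + l3 * (t + (1 - x) / l3 - t))) = 0"
      unfolding x1 D_def prod.case char_fun_diff by simp
    show "\<exists>p'. ((\<lambda>z. char_fun (- \<i> * k) (D h z)) has_derivative p') (at (r, y)) \<and>
        p' (1, l3) = - \<i> * k * l3 * char_fun (- \<i> * k) (D h (r, y))"
      if r: "t + (1 - x) / l3 < r" "0 < y" "y < 1" for r y
    proof -
      have "\<exists>D'. ((\<lambda>z. char_fun (- \<i> * k) (D h z)) has_derivative D') (at (r, y)) \<and>
          D' (1, l3) = char_fun (- \<i> * k) (B *v D h (r, y))"
        using \<open>h > 0\<close> r s by (intro D_der eig) simp_all
      then show ?thesis
        by (simp only: B_def char_fun_B_mat(2))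
    qed
  qed (use that ls in auto)
  have D_plus: "char_fun k (D h (t, x)) = 0"
    if "h > 0" "t \<ge> - 1 / l3 + 1 / l1" "x \<in> {0..1}" for h t x
  proof (rule transport_zero[where s = "t - x / l1" and c = l1 and a = "\<i> * k * l1"])
    have "x / l1 \<le> 1 / l1"
      using that ls by (intro divide_right_mono) auto
    \<comment> \<open>The entry time at x = 0 must not only be nonnegative: from it onwards
      \<open>D_minus\<close> has to hold along the whole characteristic.\<close>
    then have s: "t - x / l1 \<ge> - 1 / l3"
      using that by simp
    have m: "- 1 / l3 > 0"
      using ls by (simp add: divide_neg_neg)
    with s have s0: "t - x / l1 \<ge> 0"
      by linarith
    then show "continuous_on ({t - x / l1..t} \<times> {0..1}) (\<lambda>z. char_fun k (D h z))"
      using that by (intro D_cont)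
    show "t - x / l1 \<le> t"
      using that ls by simp
    have x0: "x + l1 * (t - x / l1 - t) = 0"
      using ls by simp
    then show "x + l1 * (t - x / l1 - t) \<in> {0..1}"
      by simp
    have "B0 k *v q (t - x / l1 + h, 0) = B0 k *v q (t - x / l1, 0)"
      using boundary0 s0 that by (simp add: q_def)
    from char_fun_boundary0[OF this]
    show "char_fun k (D h (t - x / l1, x + l1 * (t - x / l1 - t))) = 0"
      unfolding x0 D_def prod.case char_fun_diff by simp
    show "\<exists>p'. ((\<lambda>z. char_fun k (D h z)) has_derivative p') (at (r, y)) \<and>
        p' (1, l1) = \<i> * k * l1 * char_fun k (D h (r, y))"
      if r: "t - x / l1 < r" "0 < y" "y < 1" for r y
    proof -
      \<comment> \<open>The coupling term in \<open>char_fun_B_mat\<close> vanishes by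
        \<open>D_minus\<close>.\<close>
      have "char_fun k (B *v D h (r, y)) = \<i> * k * l1 * char_fun k (D h (r, y))"
        using D_minus[of h r y] \<open>h > 0\<close> r s by (simp add: B_def char_fun_B_mat(1))
      moreover have "r > 0"
        using r s0 by linarith
      moreover have "\<exists>D'. ((\<lambda>z. char_fun k (D h z)) has_derivative D') (at (r, y)) \<and>
          D' (1, l1) = char_fun k (B *v D h (r, y))" if "r > 0"
        using \<open>h > 0\<close> r that by (intro D_der eig) simp_all
      ultimately show ?thesis
        by simp
    qed
  qed (use that ls in auto)
  define T where "T = - 1 / l3 + 1 / l1"
  have "1 / l1 > 0" "- 1 / l3 > 0"
    using ls by (simp_all add: divide_neg_neg)
  then have T: "T \<ge> 0" "T \<ge> - 1 / l3"
    unfolding T_def by linarith+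
  \<comment> \<open>The shift h = s - T compares every later time with the fixed time T.\<close>
  have const: "Q s x = Q T x" if "s > T" "x \<in> {0..1}" for s x
  proof -
    have "char_fun k (D (s - T) (T, x)) = 0" "char_fun (- \<i> * k) (D (s - T) (T, x)) = 0"
      using D_plus D_minus that T by (simp_all add: T_def)
    then show ?thesis
      by (intro char_fun_inject[OF k]) (simp_all add: D_def q_def char_fun_diff)
  qed
  \<comment> \<open>Strictness of t > T gives an open time interval around t on which Q is constant;
    this includes x = 0 and x = 1.\<close>
  have "((\<lambda>s. Q s x) has_vector_derivative 0) (at t)" if "t > T" "x \<in> {0..1}" for t x
  proof (rule has_vector_derivative_transform_within_open[where S = "{T<..}"])
    show "((\<lambda>s. Q T x) has_vector_derivative 0) (at t)"
      by simp
  qed (use const[OF _ that(2)] that(1) in simp_all)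
  with T show ?thesis
    by blast
qed

end
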